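(* Let $X$ be a Banach sequence space. The norm closed sublattices of $X$ are exactly the closed linear spans of (finite or infinite) disjoint positive sequences in $X$.
   Context: A Banach sequence space is a (real) Banach lattice whose order is given by a Schauder basis, i.e. it has a Schauder basis $(b_i)$ such that $x=\sum_i x_i b_i\ge 0$ if and only if $x_i\ge 0$ for all $i$. A sublattice is a linear subspace closed under $\vee$ and $\wedge$. A positive sequence is a sequence of elements $x^{(n)}\ge 0$; it is disjoint if $x^{(n)}\wedge x^{(m)}=0$ for $n\neq m$. The span of the empty sequence is $\{0\}$. *)

theory Defs
  imports "HOL-Analysis.Analysis" "HOL-Library.Lattice_Algebras"
begin

class banach_lattice = banach + ordered_real_vector + lattice_ab_group_add_abs +
  assumes norm_mono_abs: "\<bar>x\<bar> \<le> \<bar>y\<bar> \<Longrightarrow> norm x \<le> norm y"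

text \<open>A finite or infinite sequence is a function on \<^typ>\<open>nat\<close> together with an index set \<open>J\<close>,
  which is either all of \<^typ>\<open>nat\<close> or an initial segment (possibly empty). Values outside \<open>J\<close> are
  ignored.\<close>

definition seq_index :: "nat set \<Rightarrow> bool" where
  "seq_index J \<longleftrightarrow> J = UNIV \<or> (\<exists>n. J = {..<n})"

definition expansion :: "nat set \<Rightarrow> (nat \<Rightarrow> 'a::real_normed_vector) \<Rightarrow> (nat \<Rightarrow> real) \<Rightarrow> 'a \<Rightarrow> bool" where
  "expansion J b c x \<longleftrightarrow> (\<forall>i. i \<notin> J \<longrightarrow> c i = 0) \<and> (\<lambda>i. c i *\<^sub>R b i) sums x"

text \<open>For \<open>J = UNIV\<close> this is the usual notion of a Schauder basis; an initial segment \<open>J\<close> gives the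
  (ordered) bases of finite-dimensional spaces.\<close>

definition schauder_basis :: "nat set \<Rightarrow> (nat \<Rightarrow> 'a::banach) \<Rightarrow> bool" where
  "schauder_basis J b \<longleftrightarrow> seq_index J \<and> (\<forall>x. \<exists>!c. expansion J b c x)"

text \<open>The whole type is a Banach sequence space, as witnessed by the basis \<open>b\<close>.\<close>

definition banach_sequence_space :: "nat set \<Rightarrow> (nat \<Rightarrow> 'a::banach_lattice) \<Rightarrow> bool" where
  "banach_sequence_space J b \<longleftrightarrow> schauder_basis J b \<and>
     (\<forall>x c. expansion J b c x \<longrightarrow> (0 \<le> x \<longleftrightarrow> (\<forall>i\<in>J. 0 \<le> c i)))"

definition sublattice :: "'a::banach_lattice set \<Rightarrow> bool" where
  "sublattice Y \<longleftrightarrow> subspace Y \<and> (\<forall>x\<in>Y. \<forall>y\<in>Y. sup x y \<in> Y \<and> inf x y \<in> Y)"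

definition disjoint_positive_seq :: "nat set \<Rightarrow> (nat \<Rightarrow> 'a::banach_lattice) \<Rightarrow> bool" where
  "disjoint_positive_seq N x \<longleftrightarrow> seq_index N \<and> (\<forall>n\<in>N. 0 \<le> x n) \<and>
     (\<forall>n\<in>N. \<forall>m\<in>N. n \<noteq> m \<longrightarrow> inf (x n) (x m) = 0)"

end

theory Submission
  imports Defs
begin

text \<open>
  The coordinate functionals of a Banach sequence space are continuous lattice homomorphisms:
  the order is coordinatewise, so \<open>\<bar>x\<^sub>i\<bar> b\<^sub>i \<le> \<bar>x\<bar>\<close>, and the coordinates of \<open>x \<squnion> y\<close> are the maxima of the
  coordinates of \<open>x\<close> and \<open>y\<close>. Moreover the tails of a basis expansion tend to \<open>0\<close>, so an element
  whose coordinates are dominated by those of a fixed \<open>y\<close> and vanish below \<open>n\<close> has small norm when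
  \<open>n\<close> is large (lemma \<open>norm_le_tail\<close>).

  The span of a disjoint positive sequence is closed under \<open>\<bar>_\<bar>\<close>, because at each coordinate at most
  one member of the sequence is nonzero; by continuity of \<open>\<bar>_\<bar>\<close> its closure is a sublattice.

  Conversely, let \<open>Y\<close> be a closed sublattice, and call coordinates \<open>i\<close>, \<open>j\<close> equivalent if the
  restrictions to \<open>Y\<close> of their coordinate functionals are nonzero and proportional. For each \<open>i\<close>
  whose functional does not vanish on \<open>Y\<close> there is a positive \<open>u \<in> Y\<close> with \<open>u\<^sub>i = 1\<close> whose support is
  exactly the class of \<open>i\<close> (lemma \<open>class_element_exists\<close>): for each \<open>j\<close> outside the class some positive
  \<open>v \<in> Y\<close> has \<open>v\<^sub>i = 1\<close> and \<open>v\<^sub>j = 0\<close>, and the successive infima of these elements converge in norm.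
  Elements belonging to different classes are disjoint, and every \<open>y \<in> Y\<close> is the norm limit of the
  sums \<open>\<Sum> y\<^sub>k u\<^sub>k\<close> taken over the least representatives \<open>k < n\<close> of the classes.
\<close>

section \<open>Absolute values in Banach lattices\<close>

lemma abs_diff_abs_le:
  fixes x y :: "'a::lattice_ab_group_add_abs"
  shows "\<bar>\<bar>x\<bar> - \<bar>y\<bar>\<bar> \<le> \<bar>x - y\<bar>"
proof -
  have *: "\<bar>x\<bar> - \<bar>y\<bar> \<le> \<bar>x - y\<bar>" for x y :: 'a
    using abs_triangle_ineq[of "x - y" y] by (simp add: diff_le_eq)
  show ?thesis
    using *[of x y] *[of y x] abs_minus_commute[of x y] by (intro abs_leI) simp_all
qed

lemma tendsto_abs_banach_lattice:
  fixes f :: "nat \<Rightarrow> 'a::banach_lattice"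
  assumes "f \<longlonglongrightarrow> l"
  shows "(\<lambda>n. \<bar>f n\<bar>) \<longlonglongrightarrow> \<bar>l\<bar>"
proof -
  have "norm (\<bar>f n\<bar> - \<bar>l\<bar>) \<le> norm (f n - l)" for n
    by (intro norm_mono_abs abs_diff_abs_le)
  moreover have "(\<lambda>n. norm (f n - l)) \<longlonglongrightarrow> 0"
    using assms by (simp add: LIM_zero tendsto_norm_zero)
  ultimately have "(\<lambda>n. \<bar>f n\<bar> - \<bar>l\<bar>) \<longlonglongrightarrow> 0"
    by (rule Lim_null_comparison[OF always_eventually[OF allI]])
  then show ?thesis
    by (rule LIM_zero_cancel)
qed

lemma sup_eq_abs:
  fixes x y :: "'a::banach_lattice"
  shows "sup x y = y + (1/2) *\<^sub>R (\<bar>x - y\<bar> + (x - y))"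
proof -
  have "sup x y = y + pprt (x - y)"
    by (simp add: pprt_def add_sup_distrib_left)
  moreover have "\<bar>z\<bar> + z = pprt z + pprt z" for z :: 'a
  proof -
    have "\<bar>z\<bar> + z = (pprt z - nprt z) + (pprt z + nprt z)"
      by (rule arg_cong2[of _ _ _ _ "(+)", OF abs_prts prts])
    then show ?thesis by simp
  qed
  ultimately show ?thesis
    by (simp flip: scaleR_2)
qed

lemma sublattice_iff_abs:
  "sublattice Y \<longleftrightarrow> subspace Y \<and> (\<forall>x\<in>Y. \<bar>x\<bar> \<in> Y)"
proof (intro iffI conjI ballI)
  assume Y: "sublattice Y"
  show "subspace Y"
    using Y by (simp add: sublattice_def)
  fix x assume "x \<in> Y"
  with Y show "\<bar>x\<bar> \<in> Y"
    unfolding abs_lattice[of x] by (simp add: sublattice_def subspace_neg)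
next
  assume Y: "subspace Y \<and> (\<forall>x\<in>Y. \<bar>x\<bar> \<in> Y)"
  have sup: "sup x y \<in> Y" if "x \<in> Y" "y \<in> Y" for x y
    unfolding sup_eq_abs[of x y] using Y that
    by (simp add: subspace_add subspace_diff subspace_scale)
  have "inf x y \<in> Y" if "x \<in> Y" "y \<in> Y" for x y
    unfolding inf_eq_neg_sup[of x y] using Y that by (intro subspace_neg sup) auto
  with Y sup show "sublattice Y"
    by (simp add: sublattice_def)
qed

lemma subspace_closure:
  fixes S :: "'a::real_normed_vector set"
  assumes S: "subspace S"
  shows "subspace (closure S)"
proof (rule subspaceI)
  show "0 \<in> closure S"
    using subspace_0[OF S] closure_subset by blast
next
  fix x y assume "x \<in> closure S" "y \<in> closure S"
  then obtain f g where "\<And>n. f n \<in> S" "f \<longlonglongrightarrow> x" "\<And>n. g n \<in> S" "g \<longlonglongrightarrow> y"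
    by (auto simp: closure_sequential)
  then have "\<And>n. f n + g n \<in> S" "(\<lambda>n. f n + g n) \<longlonglongrightarrow> x + y"
    using S by (auto intro: subspace_add tendsto_add)
  then show "x + y \<in> closure S"
    by (auto simp: closure_sequential intro!: exI[of _ "\<lambda>n. f n + g n"])
next
  fix r :: real and x assume "x \<in> closure S"
  then obtain f where "\<And>n. f n \<in> S" "f \<longlonglongrightarrow> x"
    by (auto simp: closure_sequential)
  then have "\<And>n. r *\<^sub>R f n \<in> S" "(\<lambda>n. r *\<^sub>R f n) \<longlonglongrightarrow> r *\<^sub>R x"
    using S by (auto intro: subspace_scale tendsto_intros)
  then show "r *\<^sub>R x \<in> closure S"
    by (auto simp: closure_sequential intro!: exI[of _ "\<lambda>n. r *\<^sub>R f n"])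
qed

lemma sublattice_closure:
  assumes "sublattice Y"
  shows "sublattice (closure Y)"
  unfolding sublattice_iff_abs
proof (intro conjI ballI)
  show "subspace (closure Y)"
    using assms by (intro subspace_closure) (simp add: sublattice_def)
  fix x assume "x \<in> closure Y"
  then obtain f where f: "\<And>n. f n \<in> Y" "f \<longlonglongrightarrow> x"
    by (auto simp: closure_sequential)
  then have "\<And>n. \<bar>f n\<bar> \<in> Y" "(\<lambda>n. \<bar>f n\<bar>) \<longlonglongrightarrow> \<bar>x\<bar>"
    using assms by (auto simp: sublattice_iff_abs intro: tendsto_abs_banach_lattice)
  then show "\<bar>x\<bar> \<in> closure Y"
    by (auto simp: closure_sequential intro!: exI[of _ "\<lambda>n. \<bar>f n\<bar>"])
qed

section \<open>Coordinates in a Banach sequence space\<close>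

locale banach_sequence_space_basis =
  fixes J :: "nat set" and b :: "nat \<Rightarrow> 'a::banach_lattice"
  assumes banach_sequence_space: "banach_sequence_space J b"
begin

text \<open>The coefficient of \<open>x\<close> at the basis vector \<open>b i\<close>; it is \<open>0\<close> for indices outside \<open>J\<close>, so that
  statements about all coordinates need no restriction to \<open>J\<close>.\<close>

definition coord :: "'a \<Rightarrow> nat \<Rightarrow> real" where
  "coord x = (THE c. expansion J b c x)"

lemma expansion_unique_exists: "\<exists>!c. expansion J b c x"
  using banach_sequence_space by (auto simp: banach_sequence_space_def schauder_basis_def)

lemma expansion_coord: "expansion J b (coord x) x"
  unfolding coord_def by (rule theI'[OF expansion_unique_exists])

lemma coord_eqI: "expansion J b c x \<Longrightarrow> coord x = c"
  using expansion_unique_exists expansion_coord by blast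

lemma coord_outside: "i \<notin> J \<Longrightarrow> coord x i = 0"
  using expansion_coord[of x] by (simp add: expansion_def)

lemma coord_sums: "(\<lambda>i. coord x i *\<^sub>R b i) sums x"
  using expansion_coord[of x] by (simp add: expansion_def)

lemma coord_eq_iff: "x = y \<longleftrightarrow> (\<forall>i. coord x i = coord y i)"
  using coord_sums[of x] coord_sums[of y] by (auto dest: sums_unique2)

lemma coord_add: "coord (x + y) i = coord x i + coord y i"
proof -
  have "expansion J b (\<lambda>i. coord x i + coord y i) (x + y)"
    unfolding expansion_def
    using sums_add[OF coord_sums[of x] coord_sums[of y]]
    by (auto simp: coord_outside scaleR_add_left)
  from coord_eqI[OF this] show ?thesis by simp
qed

lemma coord_scaleR: "coord (r *\<^sub>R x) i = r * coord x i"
proof -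
  have "expansion J b (\<lambda>i. r * coord x i) (r *\<^sub>R x)"
    unfolding expansion_def
    using sums_scaleR_right[OF coord_sums[of x], of r] by (auto simp: coord_outside)
  from coord_eqI[OF this] show ?thesis by simp
qed

lemma coord_zero: "coord 0 i = 0"
  using coord_scaleR[of 0 0] by simp

lemma coord_minus: "coord (- x) i = - coord x i"
  using coord_scaleR[of "-1" x] by simp

lemma coord_diff: "coord (x - y) i = coord x i - coord y i"
  using coord_add[of x "- y"] by (simp add: coord_minus)

lemma coord_sum: "coord (\<Sum>k\<in>A. f k) i = (\<Sum>k\<in>A. coord (f k) i)"
  by (induction A rule: infinite_finite_induct) (auto simp: coord_zero coord_add)

lemma coord_basis:
  assumes "k \<in> J"
  shows "coord (b k) i = (if i = k then 1 else 0)"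
proof -
  have "(\<lambda>i. (if i = k then 1 else 0) *\<^sub>R b i) = (\<lambda>i. if i = k then b i else 0)"
    by auto
  then have "expansion J b (\<lambda>i. if i = k then 1 else 0) (b k)"
    unfolding expansion_def using assms sums_single[of k b] by auto
  from coord_eqI[OF this] show ?thesis by simp
qed

lemma nonneg_iff_coord: "0 \<le> x \<longleftrightarrow> (\<forall>i. 0 \<le> coord x i)"
proof -
  have "0 \<le> x \<longleftrightarrow> (\<forall>i\<in>J. 0 \<le> coord x i)"
    using banach_sequence_space expansion_coord[of x] by (simp add: banach_sequence_space_def)
  then show ?thesis
    using coord_outside[of _ x] by (metis order_refl)
qed

lemma le_iff_coord: "x \<le> y \<longleftrightarrow> (\<forall>i. coord x i \<le> coord y i)"
  using nonneg_iff_coord[of "y - x"] by (simp add: coord_diff)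

lemma coord_sup: "coord (sup x y) i = max (coord x i) (coord y i)"
proof (cases "i \<in> J")
  case True
  define d where "d = coord (sup x y) i - max (coord x i) (coord y i)"
  have le: "coord x j \<le> coord (sup x y) j" "coord y j \<le> coord (sup x y) j" for j
    using le_iff_coord sup_ge1 sup_ge2 by blast+
  \<comment> \<open>Lowering the \<open>i\<close>-th coordinate of the supremum to the maximum keeps an upper bound.\<close>
  have "sup x y \<le> sup x y - d *\<^sub>R b i"
  proof (rule sup_least)
    show "x \<le> sup x y - d *\<^sub>R b i" "y \<le> sup x y - d *\<^sub>R b i"
      using le True by (auto simp: le_iff_coord[of _ "_ - _"] coord_diff coord_scaleR coord_basis d_def)
  qed
  then have "coord (sup x y) i \<le> coord (sup x y) i - d"
    using le_iff_coord[THEN iffD1, THEN spec, of "sup x y" "sup x y - d *\<^sub>R b i" i] True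
    by (simp add: coord_diff coord_scaleR coord_basis)
  with le[of i] show ?thesis
    by (simp add: d_def)
qed (simp add: coord_outside)

lemma coord_inf: "coord (inf x y) i = min (coord x i) (coord y i)"
  unfolding inf_eq_neg_sup[of x y] coord_minus coord_sup by simp

lemma coord_abs: "coord \<bar>x\<bar> i = \<bar>coord x i\<bar>"
  unfolding abs_lattice[of x] coord_sup coord_minus by (simp add: max_def)

lemma norm_coord_le: "\<bar>coord x i\<bar> * norm (b i) \<le> norm x"
proof (cases "i \<in> J")
  case True
  have "norm (coord x i *\<^sub>R b i) \<le> norm x"
    using True by (intro norm_mono_abs)
      (auto simp: le_iff_coord coord_abs coord_scaleR coord_basis)
  then show ?thesis by simp
qed (simp add: coord_outside)

lemma basis_nonzero: "i \<in> J \<Longrightarrow> b i \<noteq> 0"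
  using coord_basis[of i i] coord_zero[of i] by auto

lemma tendsto_coord:
  assumes "f \<longlonglongrightarrow> l"
  shows "(\<lambda>n. coord (f n) i) \<longlonglongrightarrow> coord l i"
proof (cases "i \<in> J")
  case True
  have "norm (coord (f n) i - coord l i) \<le> norm (f n - l) / norm (b i)" for n
    using norm_coord_le[of "f n - l" i] basis_nonzero[OF True]
    by (simp add: coord_diff field_simps)
  moreover have "(\<lambda>n. norm (f n - l) / norm (b i)) \<longlonglongrightarrow> 0"
    using assms by (intro tendsto_divide_zero) (simp add: LIM_zero tendsto_norm_zero)
  ultimately have "(\<lambda>n. coord (f n) i - coord l i) \<longlonglongrightarrow> 0"
    by (rule Lim_null_comparison[OF always_eventually[OF allI]])
  then show ?thesis
    by (rule LIM_zero_cancel)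
qed (simp add: coord_outside)

text \<open>The remainder of the basis expansion of \<open>x\<close> after the terms with index below \<open>n\<close>.\<close>

definition tail :: "'a \<Rightarrow> nat \<Rightarrow> 'a" where
  "tail x n = x - (\<Sum>i<n. coord x i *\<^sub>R b i)"

lemma tail_tendsto_zero: "tail x \<longlonglongrightarrow> 0"
  using tendsto_diff[OF tendsto_const coord_sums[of x, unfolded sums_def], of x]
  unfolding tail_def[abs_def] by simp

lemma coord_tail: "coord (tail x n) j = (if j < n then 0 else coord x j)"
proof -
  have "coord (coord x i *\<^sub>R b i) j = (if i = j then coord x j else 0)" for i
    by (cases "i \<in> J") (auto simp: coord_scaleR coord_basis coord_outside coord_zero)
  then show ?thesis
    by (simp add: tail_def coord_diff coord_sum)
qed

text \<open>A quantitative form of order continuity of the norm: the bound depends only on the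
  dominating element \<open>y\<close> and on \<open>n\<close>.\<close>

lemma norm_le_tail:
  assumes "\<And>j. \<bar>coord x j\<bar> \<le> coord y j" and "\<And>j. j < n \<Longrightarrow> coord x j = 0"
  shows "norm x \<le> norm (tail y n)"
proof (rule norm_mono_abs)
  show "\<bar>x\<bar> \<le> \<bar>tail y n\<bar>"
    using assms by (auto simp: le_iff_coord coord_abs coord_tail intro: order_trans[OF _ abs_ge_self])
qed

section \<open>The closed span of a disjoint positive sequence\<close>

lemma sublattice_span_disjoint:
  fixes S :: "'a set"
  assumes nonneg: "\<And>v. v \<in> S \<Longrightarrow> 0 \<le> v"
    and disjoint: "\<And>v w. v \<in> S \<Longrightarrow> w \<in> S \<Longrightarrow> v \<noteq> w \<Longrightarrow> inf v w = 0"
  shows "sublattice (span S)"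
  unfolding sublattice_iff_abs
proof (intro conjI ballI subspace_span)
  fix y assume "y \<in> span S"
  then obtain t r where t: "finite t" "t \<subseteq> S" and y: "y = (\<Sum>v\<in>t. r v *\<^sub>R v)"
    by (auto simp: span_explicit)
  have "\<bar>y\<bar> = (\<Sum>v\<in>t. \<bar>r v\<bar> *\<^sub>R v)"
    unfolding coord_eq_iff
  proof
    fix i
    have nn: "0 \<le> coord v i" if "v \<in> t" for v
      using nonneg t that nonneg_iff_coord by blast
    have "\<bar>\<Sum>v\<in>t. r v * coord v i\<bar> = (\<Sum>v\<in>t. \<bar>r v\<bar> * coord v i)"
    proof (cases "\<exists>w\<in>t. coord w i \<noteq> 0")
      case True
      then obtain w where w: "w \<in> t" "coord w i \<noteq> 0" by blast
      have zero: "coord v i = 0" if "v \<in> t" "v \<noteq> w" for v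
      proof -
        have "min (coord v i) (coord w i) = 0"
          using disjoint[of v w] t that w by (metis coord_inf coord_zero subsetD)
        then show ?thesis
          using w(2) nn[OF w(1)] by (auto simp: min_def split: if_splits)
      qed
      have "(\<Sum>v\<in>t. g v * coord v i) = g w * coord w i" for g
        using t(1) w(1) zero by (subst sum.remove[of t w]) auto
      then show ?thesis
        using nn[OF w(1)] by (simp add: abs_mult)
    qed auto
    then show "coord \<bar>y\<bar> i = coord (\<Sum>v\<in>t. \<bar>r v\<bar> *\<^sub>R v) i"
      by (simp add: y coord_abs coord_sum coord_scaleR)
  qed
  moreover have "(\<Sum>v\<in>t. \<bar>r v\<bar> *\<^sub>R v) \<in> span S"
    using t by (intro span_sum span_scale span_base) auto
  ultimately show "\<bar>y\<bar> \<in> span S" by simp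
qed

section \<open>Generators of a closed sublattice\<close>

text \<open>The element \<open>u\<close> is supported exactly on those coordinates \<open>j\<close> whose functional is a nonzero
  multiple of the \<open>i\<close>-th one on \<open>Y\<close>; the factor is then necessarily \<open>u\<^sub>j\<close>.\<close>

lemma class_element_exists:
  fixes Y :: "'a set"
  assumes Y: "sublattice Y" "closed Y" and y0: "y0 \<in> Y" "coord y0 i \<noteq> 0"
  shows "\<exists>u\<in>Y. 0 \<le> u \<and> coord u i = 1 \<and>
           (\<forall>j. coord u j = 0 \<or> (\<forall>z\<in>Y. coord z j = coord u j * coord z i))"
proof -
  have sub: "subspace Y" and abs_mem: "\<And>x. x \<in> Y \<Longrightarrow> \<bar>x\<bar> \<in> Y"
    using Y(1) by (auto simp: sublattice_iff_abs)
  have inf_mem: "inf x z \<in> Y" if "x \<in> Y" "z \<in> Y" for x z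
    using Y(1) that by (simp add: sublattice_def)
  define y where "y = (1 / \<bar>coord y0 i\<bar>) *\<^sub>R \<bar>y0\<bar>"
  have y: "y \<in> Y" "coord y i = 1" "\<And>j. 0 \<le> coord y j"
    using y0 by (auto simp: y_def coord_scaleR coord_abs subspace_scale[OF sub] abs_mem)
  define sep where "sep j \<longleftrightarrow> (\<exists>v\<in>Y. coord v i = 1 \<and> coord v j = 0)" for j
  \<comment> \<open>If \<open>j\<close> cannot be separated from \<open>i\<close>, then the two functionals are proportional on \<open>Y\<close>:
     otherwise a suitable multiple of \<open>z - z\<^sub>i y\<close>, subtracted from \<open>y\<close>, separates them.\<close>
  have nonsep: "coord z j = coord y j * coord z i" if "\<not> sep j" "z \<in> Y" for z j
  proof (rule ccontr)
    assume ne: "coord z j \<noteq> coord y j * coord z i"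
    define d where "d = coord z j - coord z i * coord y j"
    define v where "v = y - (coord y j / d) *\<^sub>R (z - coord z i *\<^sub>R y)"
    have "v \<in> Y"
      using that y sub by (simp add: v_def subspace_diff subspace_scale)
    moreover have "coord v i = 1" "coord v j = 0"
      using y ne by (auto simp: v_def d_def coord_diff coord_scaleR)
    ultimately show False
      using that(1) by (auto simp: sep_def)
  qed
  have "\<exists>v\<in>Y. coord v i = 1 \<and> (\<forall>k. 0 \<le> coord v k) \<and> (sep j \<longrightarrow> coord v j = 0)" for j
  proof (cases "sep j")
    case True
    then obtain v where "v \<in> Y" "coord v i = 1" "coord v j = 0"
      by (auto simp: sep_def)
    then show ?thesis
      by (intro bexI[of _ "\<bar>v\<bar>"]) (auto simp: coord_abs abs_mem)
  qed (use y in auto)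
  then obtain v where v: "\<And>j. v j \<in> Y" "\<And>j. coord (v j) i = 1" "\<And>j k. 0 \<le> coord (v j) k"
    "\<And>j. sep j \<Longrightarrow> coord (v j) j = 0"
    by metis
  define w where "w = rec_nat y (\<lambda>n w. inf w (v n))"
  have w_0: "w 0 = y" and w_Suc: "\<And>n. w (Suc n) = inf (w n) (v n)"
    by (simp_all add: w_def)
  have w_mem: "w n \<in> Y" for n
    by (induction n) (simp_all add: w_0 w_Suc y v inf_mem)
  have w_i: "coord (w n) i = 1" for n
    by (induction n) (simp_all add: w_0 w_Suc y v coord_inf)
  have w_bounds: "0 \<le> coord (w n) j \<and> coord (w n) j \<le> coord y j" for n j
    by (induction n) (auto simp: w_0 w_Suc y v coord_inf min_le_iff_disj)
  have w_sep: "coord (w n) j = 0" if "sep j" "j < n" for n j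
    using that(2)
  proof (induction n)
    case (Suc n)
    then show ?case
      using v(3)[of n j] v(4)[OF that(1)] w_bounds[of n j] less_Suc_eq[of j n]
      by (auto simp: w_Suc coord_inf)
  qed simp
  have w_nonsep: "coord (w n) j = coord y j" if "\<not> sep j" for n j
    using nonsep[OF that w_mem[of n]] by (simp add: w_i)
  have w_const: "coord (w n) j = (if sep j then 0 else coord y j)" if "j < n" for n j
    using that w_sep w_nonsep by simp
  have w_tail: "norm (w m - w n) \<le> norm (tail y N)" if "N \<le> m" "N \<le> n" for m n N
  proof (rule norm_le_tail)
    show "\<bar>coord (w m - w n) j\<bar> \<le> coord y j" for j
      using w_bounds[of m j] w_bounds[of n j] unfolding coord_diff abs_le_iff by linarith
    show "coord (w m - w n) j = 0" if "j < N" for j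
      using that \<open>N \<le> m\<close> \<open>N \<le> n\<close> by (simp add: coord_diff w_const)
  qed
  have "Cauchy w"
  proof (rule CauchyI)
    fix e :: real assume "0 < e"
    then obtain N where "norm (tail y N) < e"
      using LIMSEQ_D[OF tail_tendsto_zero[of y]] by fastforce
    then show "\<exists>M. \<forall>m\<ge>M. \<forall>n\<ge>M. norm (w m - w n) < e"
      using w_tail le_less_trans by blast
  qed
  then obtain u where u: "w \<longlonglongrightarrow> u"
    by (auto simp: Cauchy_convergent_iff convergent_def)
  have coord_u: "coord u j = (if sep j then 0 else coord y j)" for j
  proof (rule LIMSEQ_unique[OF tendsto_coord[OF u]])
    have "\<forall>\<^sub>F n in sequentially. coord (w n) j = (if sep j then 0 else coord y j)"
      using eventually_gt_at_top[of j] by (rule eventually_mono) (rule w_const)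
    then show "(\<lambda>n. coord (w n) j) \<longlonglongrightarrow> (if sep j then 0 else coord y j)"
      by (rule tendsto_eventually)
  qed
  show ?thesis
  proof (intro bexI[of _ u] conjI allI)
    show "u \<in> Y"
      using Y(2) w_mem u closed_sequentially by blast
    show "0 \<le> u"
      using y(3) by (simp add: nonneg_iff_coord coord_u)
    show "coord u i = 1"
      using y(2) by (auto simp: coord_u sep_def)
    show "coord u j = 0 \<or> (\<forall>z\<in>Y. coord z j = coord u j * coord z i)" for j
      using nonsep[of j] by (auto simp: coord_u)
  qed
qed

text \<open>The zero vector is positive and disjoint from every positive element, so the generators, which
  may be finite in number, can be spread over a sequence indexed by all of \<^typ>\<open>nat\<close>.\<close>

lemma closed_sublattice_generated:
  fixes Y :: "'a set"
  assumes Y: "sublattice Y" "closed Y"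
  shows "\<exists>x. disjoint_positive_seq UNIV x \<and> Y = closure (span (range x))"
proof -
  have sub: "subspace Y"
    using Y(1) by (simp add: sublattice_def)
  define I where "I = {i. \<exists>y\<in>Y. coord y i \<noteq> 0}"
  have "\<forall>i\<in>I. \<exists>u\<in>Y. 0 \<le> u \<and> coord u i = 1 \<and>
           (\<forall>j. coord u j = 0 \<or> (\<forall>z\<in>Y. coord z j = coord u j * coord z i))"
    using class_element_exists[OF Y] unfolding I_def by blast
  then obtain u where u: "\<And>i. i \<in> I \<Longrightarrow> u i \<in> Y" "\<And>i. i \<in> I \<Longrightarrow> 0 \<le> u i"
    "\<And>i. i \<in> I \<Longrightarrow> coord (u i) i = 1"
    and factor: "\<And>i j z. i \<in> I \<Longrightarrow> coord (u i) j \<noteq> 0 \<Longrightarrow> z \<in> Y \<Longrightarrow> coord z j = coord (u i) j * coord z i"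
    by metis
  \<comment> \<open>The least members of the classes of coordinates; the other indices carry the zero vector.\<close>
  define R where "R = {i\<in>I. \<forall>k\<in>I. k < i \<longrightarrow> coord (u k) i = 0}"
  define x where "x n = (if n \<in> R then u n else 0)" for n
  have R_I: "k \<in> I" if "k \<in> R" for k
    using that by (simp add: R_def)
  \<comment> \<open>If both elements were nonzero at \<open>j\<close>, then \<open>k\<close> and \<open>l\<close> would belong to the same class.\<close>
  have disj: "coord (u k) j = 0 \<or> coord (u l) j = 0" if "k \<in> R" "l \<in> R" "k < l" for k l j
  proof (rule ccontr)
    assume ne: "\<not> ?thesis"
    have "coord (u k) j = coord (u l) j * coord (u k) l"
      using ne that by (intro factor) (auto simp: R_I u)
    moreover have "coord (u k) l = 0"
      using that by (auto simp: R_def)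
    ultimately show False
      using ne by simp
  qed
  have u_nonneg: "0 \<le> coord (u k) j" if "k \<in> R" for k j
    using u(2)[OF R_I[OF that]] by (simp add: nonneg_iff_coord)
  have x_disj: "inf (x k) (x l) = 0" if "k < l" for k l
    using that disj[of k l] u_nonneg[of k] u_nonneg[of l]
    by (auto simp: coord_eq_iff coord_inf coord_zero x_def min_def) (metis order_antisym)+
  have "disjoint_positive_seq UNIV x"
    unfolding disjoint_positive_seq_def
  proof (intro conjI ballI impI)
    show "seq_index UNIV"
      by (simp add: seq_index_def)
    show "0 \<le> x n" for n
      using u(2) R_I by (simp add: x_def)
    show "inf (x n) (x m) = 0" if "n \<noteq> m" for n m
      using x_disj[of n m] x_disj[of m n] that by (metis inf_commute nat_neq_iff)
  qed
  moreover have "closure (span (range x)) \<subseteq> Y"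
  proof (intro closure_minimal span_minimal)
    show "range x \<subseteq> Y"
      using u(1) R_I subspace_0[OF sub] by (auto simp: x_def)
  qed (use Y sub in auto)
  moreover have "y \<in> closure (span (range x))" if y: "y \<in> Y" for y
  proof -
    have rep: "\<exists>k\<in>R. k \<le> j \<and> coord (u k) j \<noteq> 0" if j: "j \<in> I" for j
    proof -
      \<comment> \<open>The least index whose element is nonzero at \<open>j\<close>; proportionality is transitive, so no
         smaller element is nonzero at that index.\<close>
      define k where "k = (LEAST k. k \<in> I \<and> coord (u k) j \<noteq> 0)"
      have j': "j \<in> I \<and> coord (u j) j \<noteq> 0"
        using j u(3) by simp
      have k: "k \<in> I" "coord (u k) j \<noteq> 0"
        using LeastI[of "\<lambda>k. k \<in> I \<and> coord (u k) j \<noteq> 0", OF j'] by (auto simp: k_def)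
      have kj: "k \<le> j"
        unfolding k_def using j' by (rule Least_le)
      have "coord (u l) k = 0" if l: "l \<in> I" "l < k" for l
      proof -
        have "coord (u l) j = 0"
          using not_less_Least[of l "\<lambda>k. k \<in> I \<and> coord (u k) j \<noteq> 0"] l by (auto simp: k_def)
        moreover have "coord (u l) j = coord (u k) j * coord (u l) k"
          using k l by (intro factor) (auto simp: u)
        ultimately show ?thesis
          using k by simp
      qed
      with k kj show ?thesis
        by (auto simp: R_def)
    qed
    define s where "s n = (\<Sum>k<n. coord y k *\<^sub>R x k)" for n
    have coord_s: "coord (s n) j = (if \<exists>k<n. k \<in> R \<and> coord (u k) j \<noteq> 0 then coord y j else 0)" for n j
    proof (cases "\<exists>k<n. k \<in> R \<and> coord (u k) j \<noteq> 0")
      case True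
      then obtain k where k: "k < n" "k \<in> R" "coord (u k) j \<noteq> 0" by blast
      have "coord (x l) j = 0" if "l \<noteq> k" for l
        using disj[of k l j] disj[of l k j] k that by (auto simp: x_def coord_zero nat_neq_iff)
      then have "(\<Sum>l<n. coord y l * coord (x l) j) = coord y k * coord (x k) j"
        using k(1) by (subst sum.remove[of _ k]) auto
      also have "\<dots> = coord y j"
        using k factor[OF R_I[OF k(2)] k(3) y] by (simp add: x_def)
      finally show ?thesis
        using True by (simp add: s_def coord_sum coord_scaleR)
    next
      case False
      then have "coord (x k) j = 0" if "k < n" for k
        using that by (auto simp: x_def coord_zero)
      then have "coord (s n) j = 0"
        by (simp add: s_def coord_sum coord_scaleR)
      then show ?thesis
        by (simp only: if_not_P[OF False])
    qed
    \<comment> \<open>Each \<open>s n\<close> is a restriction of \<open>y\<close>, and it agrees with \<open>y\<close> below \<open>n\<close> because the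
       representative of \<open>j\<close> is at most \<open>j\<close>.\<close>
    have "norm (s n - y) \<le> norm (tail \<bar>y\<bar> n)" for n
    proof (rule norm_le_tail)
      show "\<bar>coord (s n - y) j\<bar> \<le> coord \<bar>y\<bar> j" for j
        by (simp add: coord_diff coord_s coord_abs)
      show "coord (s n - y) j = 0" if "j < n" for j
      proof (cases "j \<in> I")
        case True
        then show ?thesis
          using rep[OF True] that by (auto simp: coord_diff coord_s)
      next
        case False
        then show ?thesis
          using y by (simp add: coord_diff coord_s I_def)
      qed
    qed
    then have "(\<lambda>n. s n - y) \<longlonglongrightarrow> 0"
      using tendsto_norm_zero[OF tail_tendsto_zero[of "\<bar>y\<bar>"]]
      by (rule Lim_null_comparison[OF always_eventually[OF allI]])
    then have "s \<longlonglongrightarrow> y"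
      by (rule LIM_zero_cancel)
    moreover have "s n \<in> span (range x)" for n
      unfolding s_def by (intro span_sum span_scale span_base rangeI)
    ultimately show ?thesis
      unfolding closure_sequential by blast
  qed
  ultimately show ?thesis
    by blast
qed

end

section \<open>Closed sublattices of Banach sequence spaces\<close>

theorem theorem3p2:
  fixes b :: "nat \<Rightarrow> 'a::banach_lattice" and J :: "nat set"
  assumes "banach_sequence_space J b"
  shows "{Y :: 'a set. sublattice Y \<and> closed Y} =
         {closure (span (x ` N)) | (x :: nat \<Rightarrow> 'a) N. disjoint_positive_seq N x}"
proof -
  interpret banach_sequence_space_basis J b
    by unfold_locales (rule assms)
  have "sublattice (closure (span (x ` N)))" if "disjoint_positive_seq N x" for x :: "nat \<Rightarrow> 'a" and N
  proof (intro sublattice_closure sublattice_span_disjoint)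
    show "0 \<le> v" if "v \<in> x ` N" for v
      using that \<open>disjoint_positive_seq N x\<close> by (auto simp: disjoint_positive_seq_def)
    show "inf v w = 0" if "v \<in> x ` N" "w \<in> x ` N" "v \<noteq> w" for v w
      using that \<open>disjoint_positive_seq N x\<close> by (auto simp: disjoint_positive_seq_def)
  qed
  then show ?thesis
    using closed_sublattice_generated by fastforce
qed

end
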